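(* Let $G$ be a group and let $\partial:M\to L$ be a $G$-equivariant crossed module. Then there is a bijection $$\mathbf{Bitor}_G(M\xrightarrow{\partial}L)\cong H^1(G,(M\xrightarrow{\partial}L)).$$
   Context: Groups are written multiplicatively. A crossed module $\partial:M\to L$ is a group homomorphism with an action $(\tau,m)\mapsto{}^\tau m$ of $L$ on $M$ by automorphisms such that $\partial({}^\tau m)=\tau\partial(m)\tau^{-1}$ and ${}^{\partial(n)}m=nmn^{-1}$. It is $G$-equivariant if $G$ acts on $M$ and $L$ by group automorphisms with $\partial({}^xm)={}^x\partial(m)$ and ${}^x({}^\tau m)={}^{({}^x\tau)}({}^xm)$ for $x\in G$, $\tau\in L$, $m\in M$. A right $M$-torsor is a nonempty set $P$ with a right action of $M$ and a left action of $G$ such that ${}^x(pm)={}^xp\,{}^xm$ for all $x\in G,p\in P,m\in M$, and such that for all $p,q\in P$ there is a unique $m\in M$ with $q=pm$. An $(M\xrightarrow{\partial}L)$-bitorsor is a pair $(P,\alpha)$ with $P$ a right $M$-torsor and $\alpha:P\to L$ a function such that $\alpha({}^xp)={}^x\alpha(p)$ and $\alpha(pm)=\alpha(p)\partial(m)$ for all $x\in G$, $p\in P$, $m\in M$. A morphism $(P,\alpha)\to(P',\alpha')$ is a map $P\to P'$ respecting the actions of $G$ and $M$ whose composite with $\alpha'$ is $\alpha$. $\mathbf{Bitor}_G(M\xrightarrow{\partial}L)$ is the set of isomorphism classes of $(M\xrightarrow{\partial}L)$-bitorsors. $Z^1(G,(M\xrightarrow{\partial}L))$ is the set of pairs $(f,\tau)$,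 with $f:G\to M$ a map and $\tau\in L$, such that $f(xy)=f(x)\,{}^xf(y)$ and $\tau=\partial(f(x))\,{}^x\tau$ for all $x,y\in G$. Write $(f,\tau)\sim(f',\tau')$ if there is $m\in M$ with $\tau=\partial(m)\tau'$ and $f(x)=mf'(x)({}^xm)^{-1}$ for all $x\in G$. Then $H^1(G,(M\xrightarrow{\partial}L)):=Z^1(G,(M\xrightarrow{\partial}L))/\!\sim$. *)

theory Defs
  imports "HOL-Algebra.Algebra" "HOL-Library.Equipollence"
begin

locale crossed_module =
  bd: group_hom M L \<delta> + act: group_hom L "AutoGroup M" \<theta>
  for M :: "('m, 'b) monoid_scheme" and L :: "('l, 'c) monoid_scheme"
    and \<delta> :: "'m \<Rightarrow> 'l" and \<theta> :: "'l \<Rightarrow> 'm \<Rightarrow> 'm" +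
  assumes bd_act:
      "\<lbrakk>\<tau> \<in> carrier L; m \<in> carrier M\<rbrakk>
        \<Longrightarrow> \<delta> (\<theta> \<tau> m) = \<tau> \<otimes>\<^bsub>L\<^esub> \<delta> m \<otimes>\<^bsub>L\<^esub> inv\<^bsub>L\<^esub> \<tau>"
    and peiffer:
      "\<lbrakk>n \<in> carrier M; m \<in> carrier M\<rbrakk>
        \<Longrightarrow> \<theta> (\<delta> n) m = n \<otimes>\<^bsub>M\<^esub> m \<otimes>\<^bsub>M\<^esub> inv\<^bsub>M\<^esub> n"

locale equivariant_crossed_module =
  crossed_module M L \<delta> \<theta>
  + actM: group_hom G "AutoGroup M" \<sigma>
  + actL: group_hom G "AutoGroup L" \<rho>
  for G :: "('g, 'a) monoid_scheme"
    and M :: "('m, 'b) monoid_scheme" and L :: "('l, 'c) monoid_scheme"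
    and \<delta> :: "'m \<Rightarrow> 'l" and \<theta> :: "'l \<Rightarrow> 'm \<Rightarrow> 'm"
    and \<sigma> :: "'g \<Rightarrow> 'm \<Rightarrow> 'm" and \<rho> :: "'g \<Rightarrow> 'l \<Rightarrow> 'l" +
  assumes bd_equivariant:
      "\<lbrakk>x \<in> carrier G; m \<in> carrier M\<rbrakk> \<Longrightarrow> \<delta> (\<sigma> x m) = \<rho> x (\<delta> m)"
    and act_equivariant:
      "\<lbrakk>x \<in> carrier G; \<tau> \<in> carrier L; m \<in> carrier M\<rbrakk>
        \<Longrightarrow> \<sigma> x (\<theta> \<tau> m) = \<theta> (\<rho> x \<tau>) (\<sigma> x m)"

record ('g, 'm, 'p) torsor =
  points :: "'p set"
  lact :: "'g \<Rightarrow> 'p \<Rightarrow> 'p"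
  ract :: "'p \<Rightarrow> 'm \<Rightarrow> 'p"

record ('g, 'm, 'l, 'p) bitorsor = "('g, 'm, 'p) torsor" +
  label :: "'p \<Rightarrow> 'l"

definition right_torsor ::
  "('g, 'a) monoid_scheme \<Rightarrow> ('m, 'b) monoid_scheme \<Rightarrow> ('g \<Rightarrow> 'm \<Rightarrow> 'm)
    \<Rightarrow> ('g, 'm, 'p, 'z) torsor_scheme \<Rightarrow> bool" where
  "right_torsor G M \<sigma> P \<longleftrightarrow>
     points P \<noteq> {} \<and>
     group_action G (points P) (lact P) \<and>
     (\<forall>p\<in>points P. \<forall>m\<in>carrier M. ract P p m \<in> points P) \<and>
     (\<forall>p\<in>points P. ract P p \<one>\<^bsub>M\<^esub> = p) \<and>
     (\<forall>p\<in>points P. \<forall>m\<in>carrier M. \<forall>n\<in>carrier M.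
        ract P (ract P p m) n = ract P p (m \<otimes>\<^bsub>M\<^esub> n)) \<and>
     (\<forall>x\<in>carrier G. \<forall>p\<in>points P. \<forall>m\<in>carrier M.
        lact P x (ract P p m) = ract P (lact P x p) (\<sigma> x m)) \<and>
     (\<forall>p\<in>points P. \<forall>q\<in>points P. \<exists>!m. m \<in> carrier M \<and> q = ract P p m)"

definition is_bitorsor ::
  "('g, 'a) monoid_scheme \<Rightarrow> ('m, 'b) monoid_scheme \<Rightarrow> ('l, 'c) monoid_scheme
    \<Rightarrow> ('m \<Rightarrow> 'l) \<Rightarrow> ('g \<Rightarrow> 'm \<Rightarrow> 'm) \<Rightarrow> ('g \<Rightarrow> 'l \<Rightarrow> 'l)
    \<Rightarrow> ('g, 'm, 'l, 'p) bitorsor \<Rightarrow> bool" where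
  "is_bitorsor G M L \<delta> \<sigma> \<rho> P \<longleftrightarrow>
     right_torsor G M \<sigma> P \<and>
     label P \<in> points P \<rightarrow> carrier L \<and>
     (\<forall>x\<in>carrier G. \<forall>p\<in>points P. label P (lact P x p) = \<rho> x (label P p)) \<and>
     (\<forall>p\<in>points P. \<forall>m\<in>carrier M. label P (ract P p m) = label P p \<otimes>\<^bsub>L\<^esub> \<delta> m)"

definition bitorsor_morphism ::
  "('g, 'a) monoid_scheme \<Rightarrow> ('m, 'b) monoid_scheme
    \<Rightarrow> ('g, 'm, 'l, 'p) bitorsor \<Rightarrow> ('g, 'm, 'l, 'q) bitorsor \<Rightarrow> ('p \<Rightarrow> 'q) \<Rightarrow> bool" where
  "bitorsor_morphism G M P Q h \<longleftrightarrow>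
     h \<in> points P \<rightarrow> points Q \<and>
     (\<forall>x\<in>carrier G. \<forall>p\<in>points P. h (lact P x p) = lact Q x (h p)) \<and>
     (\<forall>p\<in>points P. \<forall>m\<in>carrier M. h (ract P p m) = ract Q (h p) m) \<and>
     (\<forall>p\<in>points P. label Q (h p) = label P p)"

definition bitorsor_isomorphic ::
  "('g, 'a) monoid_scheme \<Rightarrow> ('m, 'b) monoid_scheme
    \<Rightarrow> ('g, 'm, 'l, 'p) bitorsor \<Rightarrow> ('g, 'm, 'l, 'q) bitorsor \<Rightarrow> bool" where
  "bitorsor_isomorphic G M P Q \<longleftrightarrow>
     (\<exists>h k. bitorsor_morphism G M P Q h \<and> bitorsor_morphism G M Q P k \<and>
        (\<forall>p\<in>points P. k (h p) = p) \<and> (\<forall>q\<in>points Q. h (k q) = q))"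

(* HOL has no class of all sets, so Bitor collects the bitorsors whose points lie in a
   fixed but arbitrary type 'p.  A torsor has as many points as M has elements; hence every
   bitorsor, over any type, has an isomorphic copy in 'p as soon as
   carrier M \<lesssim> (UNIV :: 'p set), and otherwise 'p carries no torsor at all.
   Records that differ only off the carriers are isomorphic, so they give the same class. *)
definition Bitor ::
  "('g, 'a) monoid_scheme \<Rightarrow> ('m, 'b) monoid_scheme \<Rightarrow> ('l, 'c) monoid_scheme
    \<Rightarrow> ('m \<Rightarrow> 'l) \<Rightarrow> ('g \<Rightarrow> 'm \<Rightarrow> 'm) \<Rightarrow> ('g \<Rightarrow> 'l \<Rightarrow> 'l)
    \<Rightarrow> ('g, 'm, 'l, 'p) bitorsor set set" where
  "Bitor G M L \<delta> \<sigma> \<rho> =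
     {P. is_bitorsor G M L \<delta> \<sigma> \<rho> P} //
     {(P, Q). is_bitorsor G M L \<delta> \<sigma> \<rho> P \<and> is_bitorsor G M L \<delta> \<sigma> \<rho> Q \<and>
        bitorsor_isomorphic G M P Q}"

definition Z1 ::
  "('g, 'a) monoid_scheme \<Rightarrow> ('m, 'b) monoid_scheme \<Rightarrow> ('l, 'c) monoid_scheme
    \<Rightarrow> ('m \<Rightarrow> 'l) \<Rightarrow> ('g \<Rightarrow> 'm \<Rightarrow> 'm) \<Rightarrow> ('g \<Rightarrow> 'l \<Rightarrow> 'l) \<Rightarrow> (('g \<Rightarrow> 'm) \<times> 'l) set" where
  "Z1 G M L \<delta> \<sigma> \<rho> =
     {(f, \<tau>). f \<in> carrier G \<rightarrow>\<^sub>E carrier M \<and> \<tau> \<in> carrier L \<and>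
        (\<forall>x\<in>carrier G. \<forall>y\<in>carrier G. f (x \<otimes>\<^bsub>G\<^esub> y) = f x \<otimes>\<^bsub>M\<^esub> \<sigma> x (f y)) \<and>
        (\<forall>x\<in>carrier G. \<tau> = \<delta> (f x) \<otimes>\<^bsub>L\<^esub> \<rho> x \<tau>)}"

definition Z1_rel ::
  "('g, 'a) monoid_scheme \<Rightarrow> ('m, 'b) monoid_scheme \<Rightarrow> ('l, 'c) monoid_scheme
    \<Rightarrow> ('m \<Rightarrow> 'l) \<Rightarrow> ('g \<Rightarrow> 'm \<Rightarrow> 'm) \<Rightarrow> ('g \<Rightarrow> 'l \<Rightarrow> 'l)
    \<Rightarrow> ((('g \<Rightarrow> 'm) \<times> 'l) \<times> (('g \<Rightarrow> 'm) \<times> 'l)) set" where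
  "Z1_rel G M L \<delta> \<sigma> \<rho> =
     {((f, \<tau>), (f', \<tau>')).
        (f, \<tau>) \<in> Z1 G M L \<delta> \<sigma> \<rho> \<and> (f', \<tau>') \<in> Z1 G M L \<delta> \<sigma> \<rho> \<and>
        (\<exists>m\<in>carrier M. \<tau> = \<delta> m \<otimes>\<^bsub>L\<^esub> \<tau>' \<and>
           (\<forall>x\<in>carrier G. f x = m \<otimes>\<^bsub>M\<^esub> f' x \<otimes>\<^bsub>M\<^esub> inv\<^bsub>M\<^esub> (\<sigma> x m)))}"

definition H1 ::
  "('g, 'a) monoid_scheme \<Rightarrow> ('m, 'b) monoid_scheme \<Rightarrow> ('l, 'c) monoid_scheme
    \<Rightarrow> ('m \<Rightarrow> 'l) \<Rightarrow> ('g \<Rightarrow> 'm \<Rightarrow> 'm) \<Rightarrow> ('g \<Rightarrow> 'l \<Rightarrow> 'l)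
    \<Rightarrow> (('g \<Rightarrow> 'm) \<times> 'l) set set" where
  "H1 G M L \<delta> \<sigma> \<rho> = Z1 G M L \<delta> \<sigma> \<rho> // Z1_rel G M L \<delta> \<sigma> \<rho>"

lemma bitorsor_isomorphic_refl: "bitorsor_isomorphic G M P P"
  unfolding bitorsor_isomorphic_def bitorsor_morphism_def
  by (rule exI[of _ id], rule exI[of _ id]) auto

lemma bitorsor_isomorphic_sym:
  "bitorsor_isomorphic G M P Q \<Longrightarrow> bitorsor_isomorphic G M Q P"
  unfolding bitorsor_isomorphic_def by blast

lemma bitorsor_morphism_comp:
  assumes "bitorsor_morphism G M P Q h" and "bitorsor_morphism G M Q R k"
  shows "bitorsor_morphism G M P R (k \<circ> h)"
  using assms unfolding bitorsor_morphism_def by (auto simp: Pi_iff)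

lemma bitorsor_isomorphic_trans:
  assumes "bitorsor_isomorphic G M P Q" and "bitorsor_isomorphic G M Q R"
  shows "bitorsor_isomorphic G M P R"
proof -
  obtain h k where hk: "bitorsor_morphism G M P Q h" "bitorsor_morphism G M Q P k"
    "\<forall>p\<in>points P. k (h p) = p" "\<forall>q\<in>points Q. h (k q) = q"
    using assms(1) unfolding bitorsor_isomorphic_def by blast
  obtain h' k' where hk': "bitorsor_morphism G M Q R h'" "bitorsor_morphism G M R Q k'"
    "\<forall>q\<in>points Q. k' (h' q) = q" "\<forall>r\<in>points R. h' (k' r) = r"
    using assms(2) unfolding bitorsor_isomorphic_def by blast
  have "h p \<in> points Q" if "p \<in> points P" for p
    using hk(1) that unfolding bitorsor_morphism_def by blast
  moreover have "k' r \<in> points Q" if "r \<in> points R" for r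
    using hk'(2) that unfolding bitorsor_morphism_def by blast
  ultimately have "\<forall>p\<in>points P. (k \<circ> k') ((h' \<circ> h) p) = p"
    and "\<forall>r\<in>points R. (h' \<circ> h) ((k \<circ> k') r) = r"
    using hk(3,4) hk'(3,4) by auto
  with bitorsor_morphism_comp[OF hk(1) hk'(1)] bitorsor_morphism_comp[OF hk'(2) hk(2)]
  show ?thesis
    unfolding bitorsor_isomorphic_def by blast
qed

end

theory Submission
  imports Defs
begin

text \<open>
  A point \<open>p\<close> of a bitorsor determines a cocycle: \<open>f x\<close> is the element of \<open>M\<close> with
  \<open>x p = p (f x)\<close>, and \<open>\<tau>\<close> is the inverse of the label of \<open>p\<close>. Moving \<open>p\<close> to \<open>p m\<close> changes this
  cocycle exactly by the equivalence relation on cocycles, and two bitorsors are isomorphic iff they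
  have points with the same cocycle. Conversely, a cocycle twists the action of \<open>G\<close> on the trivial
  torsor \<open>M\<close>.
\<close>

section \<open>Maps between quotient sets, and actions of groups\<close>

lemma bij_betw_quotients:
  assumes r: "equiv A r" and s: "equiv B s"
    and into: "\<And>a. a \<in> A \<Longrightarrow> \<phi> a \<in> B"
    and iff: "\<And>a a'. a \<in> A \<Longrightarrow> a' \<in> A \<Longrightarrow> (a, a') \<in> r \<longleftrightarrow> (\<phi> a, \<phi> a') \<in> s"
    and onto: "\<And>b. b \<in> B \<Longrightarrow> \<exists>a\<in>A. (\<phi> a, b) \<in> s"
  shows "bij_betw (\<lambda>C. s `` (\<phi> ` C)) (A // r) (B // s)"
proof -
  \<comment> \<open>By the forward half of \<open>iff\<close>, related elements have images in one
    class of \<open>s\<close>, so the induced map on classes can be computed on any representative.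
    Injectivity is then the backward half of \<open>iff\<close>, and surjectivity is
    \<open>onto\<close>.\<close>
  have cls: "s `` (\<phi> ` (r `` {a})) = s `` {\<phi> a}" if a: "a \<in> A" for a
  proof -
    have eq: "s `` {\<phi> a'} = s `` {\<phi> a}" if "a' \<in> r `` {a}" for a'
    proof -
      have "(a, a') \<in> r" "a' \<in> A"
        using that unfolding Image_singleton_iff equiv_class_eq_iff[OF r] by simp_all
      then show ?thesis
        using iff[OF a] by (intro equiv_class_eq[OF s, symmetric]) blast
    qed
    have "s `` (\<phi> ` (r `` {a})) = (\<Union>a'\<in>r `` {a}. s `` {\<phi> a'})"
      by blast
    also have "\<dots> = (\<Union>a'\<in>r `` {a}. s `` {\<phi> a})"
      by (rule SUP_cong[OF refl eq])
    \<comment> \<open>The terms of the union are constant; it collapses because \<open>a\<close>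
      lies in its own class, so the index set is nonempty.\<close>
    also have "\<dots> = s `` {\<phi> a}"
      using equiv_class_self[OF r a] by blast
    finally show ?thesis .
  qed
  show ?thesis
    unfolding bij_betw_def
  proof
    show "inj_on (\<lambda>C. s `` (\<phi> ` C)) (A // r)"
    proof (rule inj_onI)
      fix C D assume "C \<in> A // r" "D \<in> A // r" and eq: "s `` (\<phi> ` C) = s `` (\<phi> ` D)"
      then obtain a b where ab: "a \<in> A" "C = r `` {a}" "b \<in> A" "D = r `` {b}"
        by (auto elim!: quotientE)
      then have "(\<phi> a, \<phi> b) \<in> s"
        using eq cls into s by (metis eq_equiv_class)
      then show "C = D"
        using ab iff equiv_class_eq[OF r] by metis
    qed
    show "(\<lambda>C. s `` (\<phi> ` C)) ` (A // r) = B // s"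
    proof (intro equalityI subsetI)
      fix D assume "D \<in> (\<lambda>C. s `` (\<phi> ` C)) ` (A // r)"
      then obtain a where "a \<in> A" "D = s `` (\<phi> ` (r `` {a}))"
        by (auto elim!: quotientE)
      then show "D \<in> B // s"
        using cls into by (auto intro: quotientI)
    next
      fix D assume "D \<in> B // s"
      then obtain b where "b \<in> B" "D = s `` {b}" by (auto elim!: quotientE)
      moreover from this onto obtain a where "a \<in> A" "(\<phi> a, b) \<in> s" by blast
      ultimately have "D = s `` (\<phi> ` (r `` {a}))" "r `` {a} \<in> A // r"
        using cls equiv_class_eq[OF s] by (auto intro: quotientI)
      then show "D \<in> (\<lambda>C. s `` (\<phi> ` C)) ` (A // r)" by blast
    qed
  qed
qed

text \<open>Bijectivity is not assumed: the inverse of \<open>\<phi> x\<close> on \<open>E\<close>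
  is the action of the inverse of \<open>x\<close>. Extensionality is assumed because elements of
  \<open>BijGroup E\<close> are extensional functions; it lets the homomorphism law be checked on
  \<open>E\<close> alone.\<close>

lemma group_actionI:
  assumes G: "group G"
    and ext: "\<And>x. x \<in> carrier G \<Longrightarrow> \<phi> x \<in> extensional E"
    and closed: "\<And>x p. x \<in> carrier G \<Longrightarrow> p \<in> E \<Longrightarrow> \<phi> x p \<in> E"
    and one: "\<And>p. p \<in> E \<Longrightarrow> \<phi> \<one>\<^bsub>G\<^esub> p = p"
    and mult: "\<And>x y p. x \<in> carrier G \<Longrightarrow> y \<in> carrier G \<Longrightarrow> p \<in> E
      \<Longrightarrow> \<phi> (x \<otimes>\<^bsub>G\<^esub> y) p = \<phi> x (\<phi> y p)"
  shows "group_action G E \<phi>"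
proof -
  interpret group G by fact
  have "bij_betw (\<phi> x) E E" if x: "x \<in> carrier G" for x
  proof (rule bij_betw_byWitness[where f' = "\<phi> (inv\<^bsub>G\<^esub> x)"])
    show "\<forall>p\<in>E. \<phi> (inv\<^bsub>G\<^esub> x) (\<phi> x p) = p" "\<forall>p\<in>E. \<phi> x (\<phi> (inv\<^bsub>G\<^esub> x) p) = p"
      using x one by (simp_all flip: mult)
  qed (use x closed in auto)
  then have "\<phi> x \<in> Bij E" if "x \<in> carrier G" for x
    using that ext by (simp add: Bij_def)
  moreover have "\<phi> (x \<otimes>\<^bsub>G\<^esub> y) = compose E (\<phi> x) (\<phi> y)"
    if "x \<in> carrier G" "y \<in> carrier G" for x y
    using that ext mult by (intro extensionalityI[of _ E]) (auto simp: compose_eq)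
  ultimately have "\<phi> \<in> hom G (BijGroup E)"
    by (auto simp: hom_def BijGroup_def)
  then show ?thesis
    unfolding group_action_def group_hom_def group_hom_axioms_def
    using G group_BijGroup by blast
qed

text \<open>Turns a homomorphism into \<open>AutoGroup H\<close> into pointwise laws. Products there
  are compositions restricted to the carrier, hence the condition on \<open>h\<close>.\<close>

lemma
  assumes "group_hom G (AutoGroup H) \<phi>"
  shows auto_action_hom: "x \<in> carrier G \<Longrightarrow> \<phi> x \<in> hom H H"
    and auto_action_mult: "x \<in> carrier G \<Longrightarrow> y \<in> carrier G \<Longrightarrow> h \<in> carrier H
      \<Longrightarrow> \<phi> (x \<otimes>\<^bsub>G\<^esub> y) h = \<phi> x (\<phi> y h)"
    and auto_action_one: "group H \<Longrightarrow> h \<in> carrier H \<Longrightarrow> \<phi> \<one>\<^bsub>G\<^esub> h = h"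
proof -
  interpret group_hom G "AutoGroup H" \<phi> by fact
  have auto: "\<phi> x \<in> auto H" if "x \<in> carrier G" for x
    using hom_closed[OF that] by (simp add: AutoGroup_def)
  then show hom: "x \<in> carrier G \<Longrightarrow> \<phi> x \<in> hom H H"
    by (simp add: auto_def)
  show "\<phi> (x \<otimes>\<^bsub>G\<^esub> y) h = \<phi> x (\<phi> y h)"
    if "x \<in> carrier G" "y \<in> carrier G" "h \<in> carrier H" for x y
    using that hom_mult[of x y] auto
    by (simp add: AutoGroup_def BijGroup_def auto_def compose_eq)
  show "\<phi> \<one>\<^bsub>G\<^esub> h = h" if "group H" "h \<in> carrier H"
    using that hom_one by (simp add: AutoGroup_def BijGroup_def)
qed

section \<open>Torsors and the difference of two points\<close>

lemma right_torsorD: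
  assumes "right_torsor G M \<sigma> P"
  shows right_torsor_nonempty: "points P \<noteq> {}"
    and right_torsor_lact_closed: "x \<in> carrier G \<Longrightarrow> p \<in> points P \<Longrightarrow> lact P x p \<in> points P"
    and right_torsor_lact_mult: "x \<in> carrier G \<Longrightarrow> y \<in> carrier G \<Longrightarrow> p \<in> points P
      \<Longrightarrow> lact P (x \<otimes>\<^bsub>G\<^esub> y) p = lact P x (lact P y p)"
    and right_torsor_ract_closed: "p \<in> points P \<Longrightarrow> m \<in> carrier M \<Longrightarrow> ract P p m \<in> points P"
    and right_torsor_ract_mult: "p \<in> points P \<Longrightarrow> m \<in> carrier M \<Longrightarrow> n \<in> carrier M
      \<Longrightarrow> ract P (ract P p m) n = ract P p (m \<otimes>\<^bsub>M\<^esub> n)"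
    and right_torsor_lact_ract: "x \<in> carrier G \<Longrightarrow> p \<in> points P \<Longrightarrow> m \<in> carrier M
      \<Longrightarrow> lact P x (ract P p m) = ract P (lact P x p) (\<sigma> x m)"
    and right_torsor_ex1: "p \<in> points P \<Longrightarrow> q \<in> points P
      \<Longrightarrow> \<exists>!m. m \<in> carrier M \<and> q = ract P p m"
proof -
  have action: "group_action G (points P) (lact P)"
    using assms by (simp add: right_torsor_def)
  show "x \<in> carrier G \<Longrightarrow> p \<in> points P \<Longrightarrow> lact P x p \<in> points P"
    by (rule group_action.element_image[OF action]) auto
  show "x \<in> carrier G \<Longrightarrow> y \<in> carrier G \<Longrightarrow> p \<in> points P
      \<Longrightarrow> lact P (x \<otimes>\<^bsub>G\<^esub> y) p = lact P x (lact P y p)"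
    by (rule group_action.composition_rule[OF action])
qed (use assms in \<open>simp_all add: right_torsor_def\<close>)

text \<open>The quotient commonly written p^{-1} q. For two points of a torsor the description is
  proper by simple transitivity.\<close>

definition torsor_diff ::
  "('m, 'b) monoid_scheme \<Rightarrow> ('g, 'm, 'p, 'z) torsor_scheme \<Rightarrow> 'p \<Rightarrow> 'p \<Rightarrow> 'm" where
  "torsor_diff M P p q = (THE m. m \<in> carrier M \<and> q = ract P p m)"

lemma
  assumes "right_torsor G M \<sigma> P" "p \<in> points P"
  shows torsor_diff_closed: "q \<in> points P \<Longrightarrow> torsor_diff M P p q \<in> carrier M"
    and ract_torsor_diff: "q \<in> points P \<Longrightarrow> ract P p (torsor_diff M P p q) = q"
    and torsor_diff_ract: "m \<in> carrier M \<Longrightarrow> torsor_diff M P p (ract P p m) = m"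
proof -
  show "q \<in> points P \<Longrightarrow> torsor_diff M P p q \<in> carrier M"
    and "q \<in> points P \<Longrightarrow> ract P p (torsor_diff M P p q) = q"
    using theI'[OF right_torsor_ex1[OF assms, of q]] by (simp_all add: torsor_diff_def)
  show "m \<in> carrier M \<Longrightarrow> torsor_diff M P p (ract P p m) = m"
    unfolding torsor_diff_def
    using right_torsor_ex1[OF assms right_torsor_ract_closed[OF assms, of m]]
    by (intro the1_equality) auto
qed

text \<open>Freeness of the action: an identity in \<open>M\<close> can be proved by letting both
  sides act on one point.\<close>

lemma right_torsor_ract_cancel:
  assumes "right_torsor G M \<sigma> P" "p \<in> points P" "m \<in> carrier M" "n \<in> carrier M"
    and "ract P p m = ract P p n"
  shows "m = n"
  using assms torsor_diff_ract by metis

text \<open>The label is inverted because labels change by right multiplication, label(p m) =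
  label(p) \<delta>(m), whereas the relation on cocycles multiplies \<tau> on the left. The
  restriction to \<open>carrier G\<close> makes the first component extensional, as
  \<open>Z1\<close> demands.\<close>

definition point_cocycle ::
  "('g, 'a) monoid_scheme \<Rightarrow> ('m, 'b) monoid_scheme \<Rightarrow> ('l, 'c) monoid_scheme
    \<Rightarrow> ('g, 'm, 'l, 'p) bitorsor \<Rightarrow> 'p \<Rightarrow> ('g \<Rightarrow> 'm) \<times> 'l" where
  "point_cocycle G M L P p =
     (\<lambda>x\<in>carrier G. torsor_diff M P p (lact P x p), inv\<^bsub>L\<^esub> (label P p))"

section \<open>The cocycle of a point and its dependence on the point\<close>

context equivariant_crossed_module
begin

lemmas \<sigma>_hom = auto_action_hom[OF actM.group_hom_axioms]
lemmas \<rho>_hom = auto_action_hom[OF actL.group_hom_axioms]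
lemmas \<sigma>_closed [simp] = hom_in_carrier[OF \<sigma>_hom]
lemmas \<sigma>_mult = hom_mult[OF \<sigma>_hom]
lemmas \<sigma>_comp = auto_action_mult[OF actM.group_hom_axioms]
lemmas \<sigma>_one = auto_action_one[OF actM.group_hom_axioms bd.G.is_group]

lemma \<rho>_group_hom: "x \<in> carrier G \<Longrightarrow> group_hom L L (\<rho> x)"
  by (intro group_hom.intro group_hom_axioms.intro bd.H.is_group \<rho>_hom)

lemma \<sigma>_group_hom: "x \<in> carrier G \<Longrightarrow> group_hom M M (\<sigma> x)"
  by (intro group_hom.intro group_hom_axioms.intro bd.G.is_group \<sigma>_hom)

abbreviation "bitors P \<equiv> is_bitorsor G M L \<delta> \<sigma> \<rho> P"
abbreviation "cocycles \<equiv> Z1 G M L \<delta> \<sigma> \<rho>"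
abbreviation "cocycle_rel \<equiv> Z1_rel G M L \<delta> \<sigma> \<rho>"
abbreviation "cocycle_at P p \<equiv> point_cocycle G M L P p"

lemma bitorsorD:
  assumes "bitors P"
  shows bitorsor_torsor: "right_torsor G M \<sigma> P"
    and bitorsor_label_closed: "p \<in> points P \<Longrightarrow> label P p \<in> carrier L"
    and bitorsor_label_lact: "x \<in> carrier G \<Longrightarrow> p \<in> points P
      \<Longrightarrow> label P (lact P x p) = \<rho> x (label P p)"
    and bitorsor_label_ract: "p \<in> points P \<Longrightarrow> m \<in> carrier M
      \<Longrightarrow> label P (ract P p m) = label P p \<otimes>\<^bsub>L\<^esub> \<delta> m"
  using assms by (auto simp: is_bitorsor_def)

text \<open>A way to recognise the cocycle of a point without computing \<open>torsor_diff\<close>: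
  since \<open>f\<close> is extensional, it suffices to verify x p = p f(x) for each x in
  \<open>G\<close>.\<close>

lemma point_cocycle_eq_iff:
  assumes P: "bitors P" and p: "p \<in> points P" and f: "f \<in> carrier G \<rightarrow>\<^sub>E carrier M"
    and \<tau>: "\<tau> \<in> carrier L"
  shows "cocycle_at P p = (f, \<tau>) \<longleftrightarrow>
    (\<forall>x\<in>carrier G. lact P x p = ract P p (f x)) \<and> \<tau> = inv\<^bsub>L\<^esub> (label P p)"
proof -
  note T = bitorsor_torsor[OF P]
  have "torsor_diff M P p (lact P x p) = f x \<longleftrightarrow> lact P x p = ract P p (f x)"
    if x: "x \<in> carrier G" for x
    using ract_torsor_diff[OF T p right_torsor_lact_closed[OF T x p]]
      torsor_diff_ract[OF T p PiE_mem[OF f x]] by auto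
  moreover have "(\<lambda>x\<in>carrier G. torsor_diff M P p (lact P x p)) = f \<longleftrightarrow>
      (\<forall>x\<in>carrier G. torsor_diff M P p (lact P x p) = f x)"
    using f by (auto simp: PiE_iff intro!: extensionalityI[of _ "carrier G"])
  ultimately show ?thesis
    by (auto simp: point_cocycle_def)
qed

lemma lact_point_cocycle:
  assumes P: "bitors P" and p: "p \<in> points P" and x: "x \<in> carrier G"
  shows "ract P p (fst (cocycle_at P p) x) = lact P x p"
  using x ract_torsor_diff[OF bitorsor_torsor[OF P] p]
    right_torsor_lact_closed[OF bitorsor_torsor[OF P] x p]
  by (simp add: point_cocycle_def)

text \<open>The cocycle law comes from (x y) p = x (y p) after cancelling p. The condition on \<tau>
  comes from computing the label of x p = p f(x) in two ways, as \<rho>_x(label(p)) and as label(p)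
  \<delta>(f(x)), and inverting.\<close>

lemma point_cocycle_in_Z1:
  assumes P: "bitors P" and p: "p \<in> points P"
  shows "cocycle_at P p \<in> cocycles"
proof -
  note T = bitorsor_torsor[OF P]
  define f where "f = fst (cocycle_at P p)"
  have f_PiE: "f \<in> carrier G \<rightarrow>\<^sub>E carrier M"
    using torsor_diff_closed[OF T p] right_torsor_lact_closed[OF T _ p]
    by (simp add: f_def point_cocycle_def)
  then have f: "f x \<in> carrier M" if "x \<in> carrier G" for x
    using that by auto
  have lact: "lact P x p = ract P p (f x)" if "x \<in> carrier G" for x
    using lact_point_cocycle[OF P p that] by (simp add: f_def)
  have "f (x \<otimes>\<^bsub>G\<^esub> y) = f x \<otimes>\<^bsub>M\<^esub> \<sigma> x (f y)" if xy: "x \<in> carrier G" "y \<in> carrier G" for x y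
  proof (rule right_torsor_ract_cancel[OF T p])
    have "ract P p (f (x \<otimes>\<^bsub>G\<^esub> y)) = lact P x (lact P y p)"
      using xy p right_torsor_lact_mult[OF T] by (simp flip: lact)
    also have "\<dots> = ract P (ract P p (f x)) (\<sigma> x (f y))"
      using xy p f right_torsor_lact_ract[OF T] by (simp add: lact)
    finally show "ract P p (f (x \<otimes>\<^bsub>G\<^esub> y)) = ract P p (f x \<otimes>\<^bsub>M\<^esub> \<sigma> x (f y))"
      using xy p f right_torsor_ract_mult[OF T] by simp
  qed (use xy f in simp_all)
  moreover have "inv\<^bsub>L\<^esub> (label P p) = \<delta> (f x) \<otimes>\<^bsub>L\<^esub> \<rho> x (inv\<^bsub>L\<^esub> (label P p))"
    if x: "x \<in> carrier G" for x
  proof -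
    have l: "label P p \<in> carrier L"
      using bitorsor_label_closed[OF P p] .
    have "\<rho> x (inv\<^bsub>L\<^esub> (label P p)) = inv\<^bsub>L\<^esub> (label P (lact P x p))"
      using group_hom.hom_inv[OF \<rho>_group_hom[OF x] l] bitorsor_label_lact[OF P x p] by simp
    also have "\<dots> = inv\<^bsub>L\<^esub> (\<delta> (f x)) \<otimes>\<^bsub>L\<^esub> inv\<^bsub>L\<^esub> (label P p)"
      using x f l by (simp add: lact bitorsor_label_ract[OF P p] bd.H.inv_mult_group)
    finally show ?thesis
      using x f l by (simp flip: bd.H.m_assoc)
  qed
  moreover have "cocycle_at P p = (f, inv\<^bsub>L\<^esub> (label P p))"
    by (simp add: f_def point_cocycle_def)
  ultimately show ?thesis
    using f_PiE bitorsor_label_closed[OF P p] by (simp add: Z1_def)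
qed

text \<open>With g the function belonging to p, one has x (p m) = p (g(x) \<sigma>_x(m)) and (p m)
  f(x) = p (m f(x)). Equating these and cancelling p gives the coboundary formula; inverting label(p
  m) = label(p) \<delta>(m) gives the condition on \<tau>.\<close>

lemma point_cocycle_ract_eq_iff:
  assumes P: "bitors P" and p: "p \<in> points P" and m: "m \<in> carrier M"
    and c: "(f, \<tau>) \<in> cocycles"
  shows "cocycle_at P (ract P p m) = (f, \<tau>) \<longleftrightarrow>
    snd (cocycle_at P p) = \<delta> m \<otimes>\<^bsub>L\<^esub> \<tau> \<and>
    (\<forall>x\<in>carrier G. fst (cocycle_at P p) x = m \<otimes>\<^bsub>M\<^esub> f x \<otimes>\<^bsub>M\<^esub> inv\<^bsub>M\<^esub> (\<sigma> x m))"
proof -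
  note T = bitorsor_torsor[OF P]
  define g where "g = fst (cocycle_at P p)"
  have g: "g x \<in> carrier M" if "x \<in> carrier G" for x
    using point_cocycle_in_Z1[OF P p] that by (auto simp: Z1_def g_def)
  have f: "f x \<in> carrier M" if "x \<in> carrier G" for x
    using c that by (auto simp: Z1_def)
  have \<tau>: "\<tau> \<in> carrier L"
    using c by (auto simp: Z1_def)
  have l: "label P p \<in> carrier L"
    using bitorsor_label_closed[OF P p] .
  have "lact P x (ract P p m) = ract P (ract P p m) (f x) \<longleftrightarrow>
      g x = m \<otimes>\<^bsub>M\<^esub> f x \<otimes>\<^bsub>M\<^esub> inv\<^bsub>M\<^esub> (\<sigma> x m)" if x: "x \<in> carrier G" for x
  proof -
    have "lact P x (ract P p m) = ract P p (g x \<otimes>\<^bsub>M\<^esub> \<sigma> x m)"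
      using x p m g right_torsor_lact_ract[OF T] right_torsor_ract_mult[OF T]
      by (simp add: g_def flip: lact_point_cocycle[OF P])
    moreover have "ract P (ract P p m) (f x) = ract P p (m \<otimes>\<^bsub>M\<^esub> f x)"
      using x p m f right_torsor_ract_mult[OF T] by simp
    moreover have "g x \<otimes>\<^bsub>M\<^esub> \<sigma> x m = m \<otimes>\<^bsub>M\<^esub> f x \<longleftrightarrow>
        g x = m \<otimes>\<^bsub>M\<^esub> f x \<otimes>\<^bsub>M\<^esub> inv\<^bsub>M\<^esub> (\<sigma> x m)"
      using x m f g bd.G.inv_solve_right[of "g x" "m \<otimes>\<^bsub>M\<^esub> f x" "\<sigma> x m"] by auto
    ultimately show ?thesis
      using right_torsor_ract_cancel[OF T p] x m f g by (metis bd.G.m_closed \<sigma>_closed)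
  qed
  moreover have "\<tau> = inv\<^bsub>L\<^esub> (label P (ract P p m)) \<longleftrightarrow> inv\<^bsub>L\<^esub> (label P p) = \<delta> m \<otimes>\<^bsub>L\<^esub> \<tau>"
    using m l \<tau> bd.H.inv_solve_left[of \<tau> "\<delta> m" "inv\<^bsub>L\<^esub> (label P p)"]
    by (auto simp: bitorsor_label_ract[OF P p] bd.H.inv_mult_group)
  moreover have "f \<in> carrier G \<rightarrow>\<^sub>E carrier M"
    using c by (simp add: Z1_def)
  ultimately show ?thesis
    using point_cocycle_eq_iff[OF P right_torsor_ract_closed[OF T p m], of f \<tau>] \<tau>
    by (simp add: g_def) (auto simp: point_cocycle_def)
qed

text \<open>As every point has the form p m, the class of the cocycle of p consists of the cocycles
  of all points of the same bitorsor.\<close>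

lemma Z1_rel_iff_ract:
  assumes P: "bitors P" and p: "p \<in> points P" and c: "c \<in> cocycles"
  shows "(cocycle_at P p, c) \<in> cocycle_rel \<longleftrightarrow>
    (\<exists>m\<in>carrier M. cocycle_at P (ract P p m) = c)"
proof (cases c)
  case (Pair f \<tau>)
  then show ?thesis
    using point_cocycle_in_Z1[OF P p] point_cocycle_ract_eq_iff[OF P p] c
    by (cases "cocycle_at P p") (auto simp: Z1_rel_def)
qed

section \<open>Isomorphism of bitorsors in terms of cocycles\<close>

lemma bitorsor_morphism_of_eq_point_cocycle:
  assumes P: "bitors P" and Q: "bitors Q" and p: "p \<in> points P" and q: "q \<in> points Q"
    and eq: "cocycle_at P p = cocycle_at Q q"
  shows "bitorsor_morphism G M P Q (\<lambda>r. ract Q q (torsor_diff M P p r))"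
proof -
  note T = bitorsor_torsor[OF P] and U = bitorsor_torsor[OF Q]
  \<comment> \<open>The map \<open>?h\<close> sends p m to q m, the only choice compatible with the
    right actions and with p going to q. It respects \<open>G\<close> because x (p m) = p (f(x)
    \<sigma>_x(m)), and the same formula holds at q with the same f.\<close>
  let ?d = "torsor_diff M P p" and ?h = "\<lambda>r. ract Q q (torsor_diff M P p r)"
  define f where "f = fst (cocycle_at P p)"
  have f: "f x \<in> carrier M" if "x \<in> carrier G" for x
    using point_cocycle_in_Z1[OF P p] that by (auto simp: Z1_def f_def)
  have lactP: "lact P x p = ract P p (f x)" and lactQ: "lact Q x q = ract Q q (f x)"
    if "x \<in> carrier G" for x
    using lact_point_cocycle[OF P p that] lact_point_cocycle[OF Q q that] eq
    by (simp_all add: f_def)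
  \<comment> \<open>Equal second components say that the inverses of the two labels agree, and
    inversion in \<open>L\<close> is injective.\<close>
  have label: "label P p = label Q q"
    using eq bitorsor_label_closed[OF P p] bitorsor_label_closed[OF Q q]
    by (auto simp: point_cocycle_def intro: bd.H.inv_inj[THEN inj_onD])
  have d: "?d r \<in> carrier M" "ract P p (?d r) = r" if "r \<in> points P" for r
    using torsor_diff_closed[OF T p that] ract_torsor_diff[OF T p that] .
  have h: "?h (ract P p m) = ract Q q m" if "m \<in> carrier M" for m
    using torsor_diff_ract[OF T p that] by simp
  have "?h (lact P x r) = lact Q x (?h r)" if x: "x \<in> carrier G" and r: "r \<in> points P" for x r
  proof -
    have "lact P x r = lact P x (ract P p (?d r))"
      using d[OF r] by simp
    also have "\<dots> = ract P p (f x \<otimes>\<^bsub>M\<^esub> \<sigma> x (?d r))"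
      using x p f d(1)[OF r] right_torsor_lact_ract[OF T] right_torsor_ract_mult[OF T]
      by (simp add: lactP)
    finally have "?h (lact P x r) = ract Q q (f x \<otimes>\<^bsub>M\<^esub> \<sigma> x (?d r))"
      using h x r f d by simp
    also have "\<dots> = lact Q x (?h r)"
      using x q r f d right_torsor_lact_ract[OF U] right_torsor_ract_mult[OF U]
      by (simp add: lactQ)
    finally show ?thesis .
  qed
  moreover have "?h (ract P r m) = ract Q (?h r) m" if r: "r \<in> points P" and m: "m \<in> carrier M" for r m
  proof -
    have "ract P r m = ract P (ract P p (?d r)) m"
      using d[OF r] by simp
    also have "\<dots> = ract P p (?d r \<otimes>\<^bsub>M\<^esub> m)"
      using p m d(1)[OF r] right_torsor_ract_mult[OF T] by simp
    finally show ?thesis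
      using h q r m d right_torsor_ract_mult[OF U] by simp
  qed
  moreover have "label Q (?h r) = label P r" if r: "r \<in> points P" for r
  proof -
    have "label P r = label P (ract P p (?d r))"
      using d[OF r] by simp
    then show ?thesis
      using d(1)[OF r] by (simp add: bitorsor_label_ract[OF P p] bitorsor_label_ract[OF Q q] label)
  qed
  ultimately show ?thesis
    unfolding bitorsor_morphism_def using d q right_torsor_ract_closed[OF U] by auto
qed

text \<open>The morphisms p m to q m and q m to p m, obtained by exchanging the roles of the two
  bitorsors, undo each other.\<close>

lemma isomorphic_of_eq_point_cocycle:
  assumes P: "bitors P" and Q: "bitors Q" and p: "p \<in> points P" and q: "q \<in> points Q"
    and eq: "cocycle_at P p = cocycle_at Q q"
  shows "bitorsor_isomorphic G M P Q"
  unfolding bitorsor_isomorphic_def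
proof (intro exI conjI)
  note T = bitorsor_torsor[OF P] and U = bitorsor_torsor[OF Q]
  show "bitorsor_morphism G M P Q (\<lambda>r. ract Q q (torsor_diff M P p r))"
    by (rule bitorsor_morphism_of_eq_point_cocycle[OF P Q p q eq])
  show "bitorsor_morphism G M Q P (\<lambda>r. ract P p (torsor_diff M Q q r))"
    by (rule bitorsor_morphism_of_eq_point_cocycle[OF Q P q p eq[symmetric]])
  show "\<forall>r\<in>points P. ract P p (torsor_diff M Q q (ract Q q (torsor_diff M P p r))) = r"
    and "\<forall>r\<in>points Q. ract Q q (torsor_diff M P p (ract P p (torsor_diff M Q q r))) = r"
    using torsor_diff_closed[OF T p] torsor_diff_closed[OF U q] torsor_diff_ract[OF T p]
      torsor_diff_ract[OF U q] ract_torsor_diff[OF T p] ract_torsor_diff[OF U q] by auto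
qed

text \<open>Applying \<open>h\<close> to x p = p f(x) yields x h(p) = h(p) f(x), and
  \<open>h\<close> preserves labels.\<close>

lemma point_cocycle_morphism:
  assumes P: "bitors P" and Q: "bitors Q" and p: "p \<in> points P"
    and h: "bitorsor_morphism G M P Q h"
  shows "cocycle_at Q (h p) = cocycle_at P p"
proof -
  have f: "fst (cocycle_at P p) \<in> carrier G \<rightarrow>\<^sub>E carrier M" "snd (cocycle_at P p) \<in> carrier L"
    using point_cocycle_in_Z1[OF P p] by (auto simp: Z1_def)
  have "lact Q x (h p) = ract Q (h p) (fst (cocycle_at P p) x)" if x: "x \<in> carrier G" for x
  proof -
    have "lact Q x (h p) = h (ract P p (fst (cocycle_at P p) x))"
      using h x p by (simp add: lact_point_cocycle[OF P p] bitorsor_morphism_def)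
    moreover have "fst (cocycle_at P p) x \<in> carrier M"
      using f x by auto
    ultimately show ?thesis
      using h p by (simp add: bitorsor_morphism_def)
  qed
  moreover have "snd (cocycle_at P p) = inv\<^bsub>L\<^esub> (label Q (h p))"
    using h p by (simp add: bitorsor_morphism_def point_cocycle_def)
  moreover have "h p \<in> points Q"
    using h p by (auto simp: bitorsor_morphism_def)
  ultimately have "cocycle_at Q (h p) = (fst (cocycle_at P p), snd (cocycle_at P p))"
    using point_cocycle_eq_iff[OF Q _ f] by blast
  then show ?thesis by simp
qed

text \<open>Both sides say that some point p m of \<open>P\<close> has the cocycle of q. An
  isomorphism supplies such a point as the image of q; conversely, equal cocycles at p m and q yield
  an isomorphism. The base points p and q are arbitrary.\<close>

lemma isomorphic_iff_Z1_rel: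
  assumes P: "bitors P" and Q: "bitors Q" and p: "p \<in> points P" and q: "q \<in> points Q"
  shows "bitorsor_isomorphic G M P Q \<longleftrightarrow> (cocycle_at P p, cocycle_at Q q) \<in> cocycle_rel"
proof
  note T = bitorsor_torsor[OF P]
  assume "bitorsor_isomorphic G M P Q"
  then obtain k where k: "bitorsor_morphism G M Q P k"
    unfolding bitorsor_isomorphic_def by blast
  then have kq: "k q \<in> points P"
    using q by (auto simp: bitorsor_morphism_def)
  have "cocycle_at P (ract P p (torsor_diff M P p (k q))) = cocycle_at Q q"
    using point_cocycle_morphism[OF Q P q k] ract_torsor_diff[OF T p kq] by simp
  then show "(cocycle_at P p, cocycle_at Q q) \<in> cocycle_rel"
    using Z1_rel_iff_ract[OF P p point_cocycle_in_Z1[OF Q q]] torsor_diff_closed[OF T p kq] by blast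
next
  assume "(cocycle_at P p, cocycle_at Q q) \<in> cocycle_rel"
  then obtain m where "m \<in> carrier M" "cocycle_at P (ract P p m) = cocycle_at Q q"
    using Z1_rel_iff_ract[OF P p point_cocycle_in_Z1[OF Q q]] by blast
  then show "bitorsor_isomorphic G M P Q"
    using isomorphic_of_eq_point_cocycle[OF P Q _ q] right_torsor_ract_closed[OF bitorsor_torsor[OF P] p]
    by blast
qed

section \<open>Realising a cocycle by twisting the trivial torsor\<close>

lemma ex_bitorsor_with_point_cocycle:
  assumes e: "inj_on (e :: 'm \<Rightarrow> 'p) (carrier M)" and c: "c \<in> cocycles"
  shows "\<exists>P :: ('g, 'm, 'l, 'p) bitorsor. bitors P \<and> (\<exists>p\<in>points P. cocycle_at P p = c)"
proof -
  obtain f \<tau> where c_eq: "c = (f, \<tau>)" by (cases c)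
  define d where "d = the_inv_into (carrier M) e"
  have d: "d (e m) = m" if "m \<in> carrier M" for m
    using the_inv_into_f_f[OF e that] by (simp add: d_def)
  \<comment> \<open>Read through the injection \<open>e\<close>, this is \<open>M\<close> with right
    multiplication, the twisted action sending m to f(x) \<sigma>_x(m), and the label of m equal to
    \<tau>^{-1} \<delta>(m), so that the unit has the prescribed cocycle. \<open>lact\<close> is
    restricted because a \<open>group_action\<close> consists of extensional maps.\<close>
  define P :: "('g, 'm, 'l, 'p) bitorsor" where
    "P = \<lparr>points = e ` carrier M,
          lact = (\<lambda>x. \<lambda>p\<in>e ` carrier M. e (f x \<otimes>\<^bsub>M\<^esub> \<sigma> x (d p))),
          ract = (\<lambda>p m. e (d p \<otimes>\<^bsub>M\<^esub> m)),
          label = (\<lambda>p. inv\<^bsub>L\<^esub> \<tau> \<otimes>\<^bsub>L\<^esub> \<delta> (d p))\<rparr>"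
  have f_PiE: "f \<in> carrier G \<rightarrow>\<^sub>E carrier M" and \<tau>: "\<tau> \<in> carrier L"
    and f_mult: "\<And>x y. x \<in> carrier G \<Longrightarrow> y \<in> carrier G \<Longrightarrow> f (x \<otimes>\<^bsub>G\<^esub> y) = f x \<otimes>\<^bsub>M\<^esub> \<sigma> x (f y)"
    and f_\<tau>: "\<And>x. x \<in> carrier G \<Longrightarrow> \<tau> = \<delta> (f x) \<otimes>\<^bsub>L\<^esub> \<rho> x \<tau>"
    using c by (auto simp: Z1_def c_eq)
  have f: "f x \<in> carrier M" if "x \<in> carrier G" for x
    using f_PiE that by auto
  \<comment> \<open>The cocycle law at x = y = 1 reads f(1) = f(1) f(1). This value makes the unit
    of \<open>G\<close> act trivially in the twisted action.\<close>
  have f_one: "f \<one>\<^bsub>G\<^esub> = \<one>\<^bsub>M\<^esub>"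
    using f_mult[of "\<one>\<^bsub>G\<^esub>" "\<one>\<^bsub>G\<^esub>"] f[of "\<one>\<^bsub>G\<^esub>"] by (simp add: \<sigma>_one del: actM.hom_one)
  have points: "points P = e ` carrier M"
    by (simp add: P_def)
  have lact: "lact P x (e m) = e (f x \<otimes>\<^bsub>M\<^esub> \<sigma> x m)" if "m \<in> carrier M" for x m
    using that by (simp add: P_def d)
  have "lact P x \<in> extensional (points P)" for x
    by (simp add: P_def)
  then have action: "group_action G (points P) (lact P)"
    by (intro group_actionI[OF actM.G.is_group])
      (auto simp: points lact f f_one f_mult \<sigma>_one \<sigma>_mult \<sigma>_comp bd.G.m_assoc
        simp del: actM.hom_one actM.hom_mult)
  have "\<exists>!m. m \<in> carrier M \<and> e b = e (a \<otimes>\<^bsub>M\<^esub> m)" if ab: "a \<in> carrier M" "b \<in> carrier M" for a b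
  proof (rule ex1I[of _ "inv\<^bsub>M\<^esub> a \<otimes>\<^bsub>M\<^esub> b"])
    show "inv\<^bsub>M\<^esub> a \<otimes>\<^bsub>M\<^esub> b \<in> carrier M \<and> e b = e (a \<otimes>\<^bsub>M\<^esub> (inv\<^bsub>M\<^esub> a \<otimes>\<^bsub>M\<^esub> b))"
      using ab by (simp flip: bd.G.m_assoc)
    show "m = inv\<^bsub>M\<^esub> a \<otimes>\<^bsub>M\<^esub> b" if "m \<in> carrier M \<and> e b = e (a \<otimes>\<^bsub>M\<^esub> m)" for m
      using ab that inj_onD[OF e, of b "a \<otimes>\<^bsub>M\<^esub> m"] by (simp flip: bd.G.m_assoc)
  qed
  then have "right_torsor G M \<sigma> P"
    unfolding right_torsor_def using action
    by (auto simp: P_def d f \<sigma>_mult bd.G.m_assoc)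
  moreover have "inv\<^bsub>L\<^esub> \<tau> \<otimes>\<^bsub>L\<^esub> \<delta> (f x \<otimes>\<^bsub>M\<^esub> \<sigma> x m) = \<rho> x (inv\<^bsub>L\<^esub> \<tau> \<otimes>\<^bsub>L\<^esub> \<delta> m)"
    if x: "x \<in> carrier G" and m: "m \<in> carrier M" for x m
  proof -
    interpret rx: group_hom L L "\<rho> x" using \<rho>_group_hom[OF x] .
    \<comment> \<open>The inverse of \<tau> = \<delta>(f(x)) \<rho>_x(\<tau>) ends in
      \<delta>(f(x))^{-1}, which cancels. This is what makes the label equivariant for the twisted
      action.\<close>
    have "inv\<^bsub>L\<^esub> \<tau> \<otimes>\<^bsub>L\<^esub> \<delta> (f x) = inv\<^bsub>L\<^esub> (\<rho> x \<tau>)"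
    proof (subst f_\<tau>[OF x])
      show "inv\<^bsub>L\<^esub> (\<delta> (f x) \<otimes>\<^bsub>L\<^esub> \<rho> x \<tau>) \<otimes>\<^bsub>L\<^esub> \<delta> (f x) = inv\<^bsub>L\<^esub> (\<rho> x \<tau>)"
        using x f \<tau> by (simp add: bd.H.inv_mult_group bd.H.m_assoc)
    qed
    then show ?thesis
      using x m f \<tau> by (simp add: bd_equivariant flip: bd.H.m_assoc)
  qed
  ultimately have P: "bitors P"
    using \<tau> f by (auto simp: is_bitorsor_def P_def d bd.H.m_assoc)
  have p: "e \<one>\<^bsub>M\<^esub> \<in> points P"
    by (simp add: P_def)
  \<comment> \<open>Since \<sigma>_x fixes the unit, x sends it to f(x), which is also its right
    translate by f(x); its label is \<tau>^{-1}.\<close>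
  have "cocycle_at P (e \<one>\<^bsub>M\<^esub>) = c"
    unfolding c_eq point_cocycle_eq_iff[OF P p f_PiE \<tau>]
    using \<tau> f group_hom.hom_one[OF \<sigma>_group_hom] by (simp add: P_def d)
  with P p show ?thesis by blast
qed

text \<open>No computation with cocycles is needed: each one is the cocycle of a point of a bitorsor
  with points in \<open>'m\<close>, and between such cocycles the relation is isomorphism of the
  bitorsors.\<close>

lemma equiv_Z1_rel: "equiv cocycles cocycle_rel"
proof -
  have rep: thesis if "c \<in> cocycles"
    and "\<And>(P :: ('g, 'm, 'l, 'm) bitorsor) p.
      bitors P \<Longrightarrow> p \<in> points P \<Longrightarrow> c = cocycle_at P p \<Longrightarrow> thesis" for c thesis
    using ex_bitorsor_with_point_cocycle[OF inj_on_id that(1)] that(2) by blast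
  have sub: "cocycle_rel \<subseteq> cocycles \<times> cocycles"
    by (auto simp: Z1_rel_def)
  show ?thesis
  proof (rule equivI)
    show "refl_on cocycles cocycle_rel"
    proof (rule refl_onI)
      fix c assume "c \<in> cocycles"
      then show "(c, c) \<in> cocycle_rel"
        by (elim rep) (simp add: bitorsor_isomorphic_refl flip: isomorphic_iff_Z1_rel)
    qed
    show "sym cocycle_rel"
    proof (rule symI)
      fix b c assume bc: "(b, c) \<in> cocycle_rel"
      then have "b \<in> cocycles" "c \<in> cocycles" using sub by auto
      with bc show "(c, b) \<in> cocycle_rel"
        by (elim rep) (auto simp flip: isomorphic_iff_Z1_rel intro: bitorsor_isomorphic_sym)
    qed
    show "trans cocycle_rel"
    proof (rule transI)
      fix a b c assume abc: "(a, b) \<in> cocycle_rel" "(b, c) \<in> cocycle_rel"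
      then have "a \<in> cocycles" "b \<in> cocycles" "c \<in> cocycles" using sub by auto
      with abc show "(a, c) \<in> cocycle_rel"
        by (elim rep) (auto simp flip: isomorphic_iff_Z1_rel intro: bitorsor_isomorphic_trans)
    qed
  qed (use sub in auto)
qed

end

section \<open>The bijection on isomorphism classes\<close>

theorem proposition23:
  fixes G :: "('g, 'a) monoid_scheme"
    and M :: "('m, 'b) monoid_scheme" and L :: "('l, 'c) monoid_scheme"
    and \<delta> :: "'m \<Rightarrow> 'l" and \<theta> :: "'l \<Rightarrow> 'm \<Rightarrow> 'm"
    and \<sigma> :: "'g \<Rightarrow> 'm \<Rightarrow> 'm" and \<rho> :: "'g \<Rightarrow> 'l \<Rightarrow> 'l"
  assumes "equivariant_crossed_module G M L \<delta> \<theta> \<sigma> \<rho>"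
    and "carrier M \<lesssim> (UNIV :: 'p set)"
  shows "\<exists>\<Phi>. bij_betw \<Phi>
           (Bitor G M L \<delta> \<sigma> \<rho> :: ('g, 'm, 'l, 'p) bitorsor set set)
           (H1 G M L \<delta> \<sigma> \<rho>)"
proof -
  interpret equivariant_crossed_module G M L \<delta> \<theta> \<sigma> \<rho> by fact
  \<comment> \<open>This injection carries the twisted torsors over to points of type
    \<open>'p\<close>, which gives surjectivity.\<close>
  obtain e :: "'m \<Rightarrow> 'p" where e: "inj_on e (carrier M)"
    using assms(2) by (auto simp: lepoll_def)
  let ?A = "{P :: ('g, 'm, 'l, 'p) bitorsor. bitors P}"
  let ?r = "{(P, Q). bitors P \<and> bitors Q \<and> bitorsor_isomorphic G M P Q} ::
    (('g, 'm, 'l, 'p) bitorsor \<times> ('g, 'm, 'l, 'p) bitorsor) set"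
  \<comment> \<open>An arbitrary base point in each bitorsor; another choice would change the
    cocycle only within its class.\<close>
  let ?base = "\<lambda>P :: ('g, 'm, 'l, 'p) bitorsor. SOME p. p \<in> points P"
  have base: "?base P \<in> points P" if "bitors P" for P :: "('g, 'm, 'l, 'p) bitorsor"
    using right_torsor_nonempty[OF bitorsor_torsor[OF that]] by (simp add: some_in_eq)
  have "equiv ?A ?r"
    by (rule equivI)
      (auto simp: refl_on_def sym_def trans_def bitorsor_isomorphic_refl
        intro: bitorsor_isomorphic_sym bitorsor_isomorphic_trans)
  then have "bij_betw (\<lambda>C. cocycle_rel `` ((\<lambda>P. cocycle_at P (?base P)) ` C))
      (?A // ?r) (cocycles // cocycle_rel)"
  proof (rule bij_betw_quotients[OF _ equiv_Z1_rel])
    show "cocycle_at P (?base P) \<in> cocycles" if "P \<in> ?A" for P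
      using that by (simp add: base point_cocycle_in_Z1)
    show "(P, Q) \<in> ?r \<longleftrightarrow> (cocycle_at P (?base P), cocycle_at Q (?base Q)) \<in> cocycle_rel"
      if "P \<in> ?A" "Q \<in> ?A" for P Q
      using that by (simp add: isomorphic_iff_Z1_rel[OF _ _ base base])
    show "\<exists>P\<in>?A. (cocycle_at P (?base P), c) \<in> cocycle_rel" if c: "c \<in> cocycles" for c
    proof -
      obtain P :: "('g, 'm, 'l, 'p) bitorsor" and p
        where P: "bitors P" and p: "p \<in> points P" "cocycle_at P p = c"
        using ex_bitorsor_with_point_cocycle[OF e c] by blast
      \<comment> \<open>The point p realising \<open>c\<close> may differ from the chosen base
        point. Comparing \<open>P\<close> with itself at these two points relates their
        cocycles.\<close>
      have "(cocycle_at P (?base P), c) \<in> cocycle_rel"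
        using isomorphic_iff_Z1_rel[OF P P base[OF P] p(1)] p(2) bitorsor_isomorphic_refl[of G M P]
        by simp
      with P show ?thesis by blast
    qed
  qed
  then show ?thesis
    unfolding Bitor_def H1_def by blast
qed

end
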